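(* Let $\Theta\subset\mathbb{R}^{p}$ and $\Theta'\subset\mathbb{R}^{p'}$ be compact sets, equipped with (Borel) probability distributions $\mathbb{P}$ and $\mathbb{Q}$ respectively. Let $\mathcal{F}:\Theta\times\Theta'\to\mathbb{R}^{N_h}$, $(\boldsymbol{\mu},\boldsymbol{\nu})\mapsto \mathbf{u}_{\boldsymbol{\mu},\boldsymbol{\nu}}$, be continuous. For each $\boldsymbol{\mu}\in\Theta$ let $\mathscr{S}_{\boldsymbol{\mu}}:=\{\mathbf{u}_{\boldsymbol{\mu},\boldsymbol{\nu}}\}_{\boldsymbol{\nu}\in\Theta'}\subset\mathcal{F}(\Theta\times\Theta')$. Let $\mathbb{G}\in\mathbb{R}^{N_h\times N_h}$ be the Gram matrix (symmetric positive definite) of a given inner product on $\mathbb{R}^{N_h}$ and let $\|\cdot\|$ be the corresponding norm, $\|\mathbf{u}\|=\sqrt{\mathbf{u}^\top\mathbb{G}\mathbf{u}}$. Let $n\ge 1$ be an integer. Then, for every $\varepsilon>0$ there exists a ReLU matrix-valued deep neural network $\mathbf{V}:\mathbb{R}^{p}\to\mathbb{R}^{N_h\times n}$ such that, writing $\mathbf{V}_{\boldsymbol{\mu}}:=\mathbf{V}(\boldsymbol{\mu})$, $$\mathbb{E}_{\boldsymbol{\mu},\boldsymbol{\nu}}\|\mathbf{u}_{\boldsymbol{\mu},\boldsymbol{\nu}}-\mathbf{V}_{\boldsymbol{\mu}}\mathbf{V}_{\boldsymbol{\mu}}^{\top}\mathbb{G}\mathbf{u}_{\boldsymbol{\mu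},\boldsymbol{\nu}}\|<\varepsilon+\mathbb{E}_{\boldsymbol{\mu}}\left[d_{n}(\mathscr{S}_{\boldsymbol{\mu}})\right].$$
   Context: For $S\subset\mathbb{R}^{N_h}$, the Kolmogorov $n$-width is $$d_n(S):=\inf_{\mathbb{V}\in\mathbb{R}^{N_h\times n}}\;\sup_{\mathbf{u}\in S}\;\|\mathbf{u}-\mathbb{V}\mathbb{V}^{\top}\mathbb{G}\mathbf{u}\|.$$ For measurable $f:\Theta\times\Theta'\to[0,+\infty]$ and $g:\Theta\to[0,+\infty]$, $$\mathbb{E}_{\boldsymbol{\mu},\boldsymbol{\nu}}[f(\boldsymbol{\mu},\boldsymbol{\nu})]:=\int_{\Theta}\int_{\Theta'}f(\boldsymbol{\mu},\boldsymbol{\nu})\,\mathbb{P}(d\boldsymbol{\mu})\,\mathbb{Q}(d\boldsymbol{\nu}),\qquad \mathbb{E}_{\boldsymbol{\mu}}[g(\boldsymbol{\mu})]:=\int_{\Theta}g(\boldsymbol{\mu})\,\mathbb{P}(d\boldsymbol{\mu}).$$ A ReLU deep neural network $\mathbb{R}^a\to\mathbb{R}^b$ is a finite composition $A_L\circ\rho\circ A_{L-1}\circ\cdots\circ\rho\circ A_1$ of affine maps $A_i$ between finite-dimensional Euclidean spaces (of arbitrary intermediate dimensions, arbitrary depth $L$), with $\rho(t)=\max\{t,0\}$ applied componentwise. A matrix-valued network is such a map with output space $\mathbb{R}^{N_hn}$ identified with $\mathbb{R}^{N_h\times n}$. *)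

theory Defs
  imports "HOL-Probability.Probability"
begin

definition gram_norm :: "real^'h^'h \<Rightarrow> real^'h \<Rightarrow> real" where
  "gram_norm G u = sqrt (u \<bullet> (G *v u))"

text \<open>
  The width is indexed by the type \<open>'n\<close>, with \<open>n = CARD('n)\<close>. It takes values in
  \<^typ>\<open>ennreal\<close>, since the supremum is infinite for some unbounded sets. The matrix \<open>V\<close>
  ranges over all of \<open>real^'n^'h\<close>, with no orthonormality constraint.
\<close>

definition kolmogorov_width :: "'n::finite itself \<Rightarrow> real^'h^'h \<Rightarrow> (real^'h) set \<Rightarrow> ennreal" where
  "kolmogorov_width _ G S =
     (INF V::real^'n^'h. SUP u\<in>S. ennreal (gram_norm G (u - (V ** transpose V ** G) *v u)))"

text \<open>
  The widths of the hidden layers of a network are arbitrary natural numbers, so here the space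
  of dimension \<open>k\<close> is represented by the functions of type \<^typ>\<open>nat \<Rightarrow> real\<close> that vanish outside
  \<open>{..<k}\<close>.
\<close>

definition affine_layer :: "nat \<Rightarrow> nat \<Rightarrow> ((nat \<Rightarrow> real) \<Rightarrow> (nat \<Rightarrow> real)) \<Rightarrow> bool" where
  "affine_layer k m A \<longleftrightarrow>
     (\<exists>(W :: nat \<Rightarrow> nat \<Rightarrow> real) (b :: nat \<Rightarrow> real).
        \<forall>x. A x = (\<lambda>i. if i < m then (\<Sum>j<k. W i j * x j) + b i else 0))"

definition relu :: "(nat \<Rightarrow> real) \<Rightarrow> (nat \<Rightarrow> real)" where
  "relu x = (\<lambda>i. max (x i) 0)"

inductive relu_composition :: "nat \<Rightarrow> nat \<Rightarrow> ((nat \<Rightarrow> real) \<Rightarrow> (nat \<Rightarrow> real)) \<Rightarrow> bool" where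
  single: "affine_layer k m A \<Longrightarrow> relu_composition k m A"
| step: "relu_composition k l F \<Longrightarrow> affine_layer l m A \<Longrightarrow> relu_composition k m (A \<circ> relu \<circ> F)"

text \<open>
  Coordinates of a vector in a fixed enumeration of its finite index type. The choice of the
  enumeration is immaterial for the networks below, because permutations of coordinates are
  absorbed by the first and the last affine layer.
\<close>

definition coords :: "real^'a \<Rightarrow> (nat \<Rightarrow> real)" where
  "coords x = (\<lambda>j. if j < CARD('a) then x $ from_nat_into UNIV j else 0)"

lemma inj_coords: "inj (coords :: real^'a \<Rightarrow> (nat \<Rightarrow> real))"
proof (rule injI)
  fix x y :: "real^'a"
  assume eq: "coords x = coords y"
  have "bij_betw (from_nat_into (UNIV :: 'a set)) {..<CARD('a)} UNIV"
    by (simp add: bij_betw_from_nat_into_finite)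
  then have "\<exists>j<CARD('a). i = from_nat_into UNIV j" for i :: 'a
    unfolding bij_betw_def by (metis UNIV_I imageE lessThan_iff)
  with eq show "x = y"
    unfolding coords_def vec_eq_iff by metis
qed

definition relu_network :: "(real^'a \<Rightarrow> real^'b) \<Rightarrow> bool" where
  "relu_network f \<longleftrightarrow>
     (\<exists>F. relu_composition CARD('a) CARD('b) F \<and> (\<forall>x. coords (f x) = F (coords x)))"

text \<open>Matrices are flattened to vectors indexed by pairs of a row and a column index.\<close>

definition relu_matrix_network :: "(real^'a \<Rightarrow> real^'n^'h) \<Rightarrow> bool" where
  "relu_matrix_network V \<longleftrightarrow>
     relu_network (\<lambda>x. (\<chi> ij. V x $ fst ij $ snd ij) :: real^('h \<times> 'n))"

end

theory Submission
  imports Defs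
begin

text \<open>
  Write \<open>\<phi> \<mu> \<nu> V\<close> for the projection error \<open>\<parallel>u \<mu> \<nu> - V V\<^sup>T G u \<mu> \<nu>\<parallel>\<close> and
  \<open>J \<mu> V\<close> for its supremum over \<open>\<nu>\<close>; the width at \<open>\<mu>\<close> is the infimum of \<open>J \<mu> V\<close> over all
  matrices \<open>V\<close>. A minimising \<open>V\<close> depends on \<open>\<mu>\<close> in general only measurably, so the proof has to
  pass from a measurable choice to a continuous one, and from there to a network.

  Only finitely many matrices matter. Since \<open>\<phi>\<close> is uniformly continuous on compact sets, the
  infimum may be taken over a countable dense sequence of matrices. The minima over its first
  \<open>K\<close> members decrease to the width, they are bounded because \<open>\<Theta>\<close> and \<open>\<Theta>'\<close> are compact, and so
  their integrals converge to the expected width (\<open>finitely_many_candidates\<close>). Choosing for each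
  \<open>\<mu>\<close> the first good candidate gives a measurable map with finitely many values, whose expected
  worst-case error is close to the expected width.

  By inner regularity this selection is continuous on a compact set \<open>C\<close> carrying almost all of the
  mass (\<open>simple_Lusin\<close>), and Tietze's theorem extends it to \<open>\<Theta>\<close> without increasing its bound.
  A network uniformly close to the extension has almost the error of the selection on \<open>C\<close>; off
  \<open>C\<close> its error is bounded by a constant that is fixed before \<open>C\<close> is chosen, so that part of the
  integral is small (\<open>near_optimal_approximation\<close>).

  Uniform density of ReLU networks (\<open>relu_matrix_network_dense\<close>) follows from the lattice form of
  the Stone--Weierstrass theorem: the expressions built from coordinates and constants by linear
  combinations and \<open>max _ 0\<close> form a lattice and interpolate any two values. Any finite family of
  such expressions is computed by a single network, because a network can carry a value \<open>y\<close> through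
  a further layer as \<open>y = max y 0 - max (-y) 0\<close> (\<open>extend_by_relu\<close>).
\<close>

section \<open>The lattice form of the Stone--Weierstrass theorem\<close>

text \<open>
  A compactness argument: the open sets on which single members of the family lie below \<open>H\<close> cover
  \<open>S\<close>, and the minimum of the members of a finite subcover lies below \<open>H\<close> everywhere. The
  approximation theorem uses it twice, the second time with all signs reversed.
\<close>

lemma min_closed_family_below:
  fixes H :: "'a::t2_space \<Rightarrow> real"
  assumes "compact S" and H: "continuous_on S H" and "L \<noteq> {}"
    and cont: "\<And>f. f \<in> L \<Longrightarrow> continuous_on S f"
    and min: "\<And>f g. f \<in> L \<Longrightarrow> g \<in> L \<Longrightarrow> (\<lambda>x. min (f x) (g x)) \<in> L"
    and pointwise: "\<And>y. y \<in> S \<Longrightarrow> \<exists>f\<in>L. f y < H y"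
  shows "\<exists>f\<in>L. \<forall>x\<in>S. f x < H x"
proof -
  have lower: "\<exists>f\<in>L. \<forall>g\<in>C. \<forall>x. f x \<le> g x" if "finite C" "C \<subseteq> L" for C
    using that
  proof (induction C)
    case empty
    then show ?case using \<open>L \<noteq> {}\<close> by auto
  next
    case (insert g C)
    then obtain f where "f \<in> L" "\<forall>g\<in>C. \<forall>x. f x \<le> g x" by auto
    with insert.prems min[of g f] show ?case
      by (intro bexI[of _ "\<lambda>x. min (g x) (f x)"]) (auto simp: min.coboundedI2)
  qed
  obtain f where f: "\<And>y. y \<in> S \<Longrightarrow> f y \<in> L \<and> f y y < H y"
    using pointwise by metis
  have "\<exists>T. open T \<and> T \<inter> S = {x \<in> S. f y x < H x}" if "y \<in> S" for y
  proof -
    have "openin (top_of_set S) (S \<inter> (\<lambda>x. H x - f y x) -` {0<..})"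
      using f[OF that] H cont
      by (intro continuous_openin_preimage_gen continuous_intros) auto
    then obtain T where "open T" "S \<inter> (\<lambda>x. H x - f y x) -` {0<..} = S \<inter> T"
      by (auto simp: openin_open)
    then show ?thesis by (intro exI[of _ T]) auto
  qed
  then obtain T where T: "\<And>y. y \<in> S \<Longrightarrow> open (T y) \<and> T y \<inter> S = {x \<in> S. f y x < H x}"
    by metis
  obtain Y where Y: "Y \<subseteq> S" "finite Y" "S \<subseteq> (\<Union>y\<in>Y. T y)"
  proof (rule compactE_image[OF \<open>compact S\<close>, of S T])
    show "S \<subseteq> (\<Union>y\<in>S. T y)" using T f by blast
  qed (use T in auto)
  obtain h where h: "h \<in> L" "\<forall>g\<in>f ` Y. \<forall>x. h x \<le> g x"
    using lower[of "f ` Y"] Y f by auto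
  have "h x < H x" if "x \<in> S" for x
  proof -
    obtain y where y: "y \<in> Y" "x \<in> T y" using Y \<open>x \<in> S\<close> by blast
    then have "f y x < H x" using T[of y] Y that by auto
    moreover have "h x \<le> f y x" using h y by auto
    ultimately show ?thesis by simp
  qed
  with h show ?thesis by auto
qed

text \<open>
  Minima first: for each \<open>x\<close>, the members that agree with \<open>F\<close> at \<open>x\<close> yield one that is in addition
  below \<open>F + e\<close> on all of \<open>S\<close>. These functions lie above \<open>F - e\<close> near their \<open>x\<close>, so a finite
  maximum of them is above \<open>F - e\<close> on \<open>S\<close>, and it stays below \<open>F + e\<close>.
\<close>

lemma lattice_approximation:
  fixes F :: "'a::t2_space \<Rightarrow> real"
  assumes S: "compact S" and F: "continuous_on S F" and "e > 0" and "L \<noteq> {}"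
    and cont: "\<And>f. f \<in> L \<Longrightarrow> continuous_on S f"
    and min: "\<And>f g. f \<in> L \<Longrightarrow> g \<in> L \<Longrightarrow> (\<lambda>x. min (f x) (g x)) \<in> L"
    and max: "\<And>f g. f \<in> L \<Longrightarrow> g \<in> L \<Longrightarrow> (\<lambda>x. max (f x) (g x)) \<in> L"
    and interpolate: "\<And>x y. x \<in> S \<Longrightarrow> y \<in> S \<Longrightarrow> \<exists>f\<in>L. f x = F x \<and> f y = F y"
  shows "\<exists>f\<in>L. \<forall>x\<in>S. \<bar>f x - F x\<bar> < e"
proof (cases "S = {}")
  case True
  then show ?thesis using \<open>L \<noteq> {}\<close> by auto
next
  case False
  define U where "U = {f \<in> L. \<forall>z\<in>S. f z < F z + e}"
  have above: "\<exists>f\<in>U. f x = F x" if "x \<in> S" for x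
  proof -
    have "\<exists>f\<in>{f \<in> L. f x = F x}. \<forall>z\<in>S. f z < F z + e"
    proof (rule min_closed_family_below[OF S])
      show "\<exists>f\<in>{f \<in> L. f x = F x}. f y < F y + e" if "y \<in> S" for y
        using interpolate[OF \<open>x \<in> S\<close> that] \<open>e > 0\<close> by auto
    qed (use F cont min interpolate[OF that that] in \<open>auto intro!: continuous_intros\<close>)
    then show ?thesis by (auto simp: U_def)
  qed
  have "\<exists>h\<in>(\<lambda>f x. - f x) ` U. \<forall>z\<in>S. h z < e - F z"
  proof (rule min_closed_family_below[OF S])
    show "(\<lambda>x. min (f x) (g x)) \<in> (\<lambda>f x. - f x) ` U"
      if fg: "f \<in> (\<lambda>f x. - f x) ` U" "g \<in> (\<lambda>f x. - f x) ` U" for f g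
    proof -
      obtain f' g' where "f' \<in> U" "g' \<in> U" and eq: "f = (\<lambda>x. - f' x)" "g = (\<lambda>x. - g' x)"
        using fg by auto
      then have "(\<lambda>x. max (f' x) (g' x)) \<in> U" using max by (auto simp: U_def)
      moreover have "(\<lambda>x. min (f x) (g x)) = (\<lambda>x. - max (f' x) (g' x))"
        by (auto simp: eq min_def max_def)
      ultimately show ?thesis by (intro image_eqI[of _ _ "\<lambda>x. max (f' x) (g' x)"])
    qed
    show "\<exists>f\<in>(\<lambda>f x. - f x) ` U. f y < e - F y" if "y \<in> S" for y
    proof -
      obtain f where "f \<in> U" "f y = F y" using above[OF \<open>y \<in> S\<close>] by blast
      then show ?thesis using \<open>e > 0\<close> by (intro bexI[of _ "\<lambda>x. - f x"]) auto
    qed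
    show "(\<lambda>f x. - f x) ` U \<noteq> {}" using above False by auto
  qed (use F cont in \<open>auto simp: U_def intro!: continuous_intros\<close>)
  then obtain f where f: "f \<in> U" "\<forall>z\<in>S. - f z < e - F z" by auto
  then show ?thesis by (intro bexI[of _ f]) (auto simp: U_def abs_less_iff)
qed

section \<open>Functions computed by ReLU networks\<close>

lemma affine_layer_comp:
  assumes "affine_layer k l A" "affine_layer l m B"
  shows "affine_layer k m (B \<circ> A)"
proof -
  obtain W b where A: "\<And>x. A x = (\<lambda>i. if i < l then (\<Sum>j<k. W i j * x j) + b i else 0)"
    using assms(1) unfolding affine_layer_def by blast
  obtain W' b' where B: "\<And>x. B x = (\<lambda>i. if i < m then (\<Sum>j<l. W' i j * x j) + b' i else 0)"
    using assms(2) unfolding affine_layer_def by blast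
  have sum_eq: "(\<Sum>j<l. W' i j * A x j) + b' i =
      (\<Sum>p<k. (\<Sum>j<l. W' i j * W j p) * x p) + ((\<Sum>j<l. W' i j * b j) + b' i)"
    for i x
  proof -
    have "(\<Sum>j<l. W' i j * A x j) = (\<Sum>j<l. \<Sum>p<k. W' i j * W j p * x p) + (\<Sum>j<l. W' i j * b j)"
      by (simp add: A algebra_simps sum.distrib sum_distrib_left)
    also have "(\<Sum>j<l. \<Sum>p<k. W' i j * W j p * x p) = (\<Sum>p<k. \<Sum>j<l. W' i j * W j p * x p)"
      by (rule sum.swap)
    finally show ?thesis by (simp add: sum_distrib_right)
  qed
  then show ?thesis unfolding affine_layer_def comp_def
    by (intro exI[of _ "\<lambda>i p. \<Sum>j<l. W' i j * W j p"] exI[of _ "\<lambda>i. (\<Sum>j<l. W' i j * b j) + b' i"])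
      (simp only: B sum_eq simp_thms)
qed

text \<open>
  A trailing affine map is absorbed by the last layer, so it costs no activation.
\<close>

lemma relu_composition_affine:
  assumes "relu_composition k l F" "affine_layer l m B"
  shows "relu_composition k m (B \<circ> F)"
  using assms
proof (cases rule: relu_composition.cases)
  case single
  then show ?thesis
    using assms(2) affine_layer_comp relu_composition.single by blast
next
  case (step l' F' A)
  then show ?thesis
    using relu_composition.step[OF step(2) affine_layer_comp[OF step(3) assms(2)]]
    by (simp add: comp_assoc)
qed

text \<open>
  The scalar functions obtained from a network \<open>F\<close> by one more affine layer. Tracking this set
  instead of the actual outputs makes linear combinations free and leaves no ordering of the outputs
  to maintain.
\<close>

definition readouts :: "nat \<Rightarrow> ((nat \<Rightarrow> real) \<Rightarrow> (nat \<Rightarrow> real)) \<Rightarrow> (real^'a \<Rightarrow> real) set" where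
  "readouts m F = {g. \<exists>w b. \<forall>x. g x = (\<Sum>j<m. w j * F (coords x) j) + b}"

lemma readouts_const: "(\<lambda>_. c) \<in> readouts m F"
  unfolding readouts_def by (rule CollectI, rule exI[of _ "\<lambda>_. 0"]) auto

lemma readouts_output: "j < m \<Longrightarrow> (\<lambda>x. F (coords x) j) \<in> readouts m F"
  unfolding readouts_def
  by (rule CollectI, rule exI[of _ "\<lambda>i. if i = j then 1 else 0"], rule exI[of _ 0])
    (simp add: if_distrib[of "\<lambda>c. c * _"] cong: if_cong)

lemma readouts_add:
  assumes "f \<in> readouts m F" "g \<in> readouts m F"
  shows "(\<lambda>x. f x + g x) \<in> readouts m F"
proof -
  obtain w b w' b' where "\<And>x. f x = (\<Sum>j<m. w j * F (coords x) j) + b"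
      "\<And>x. g x = (\<Sum>j<m. w' j * F (coords x) j) + b'"
    using assms unfolding readouts_def by blast
  then show ?thesis unfolding readouts_def
    by (intro CollectI exI[of _ "\<lambda>j. w j + w' j"] exI[of _ "b + b'"])
      (simp add: algebra_simps sum.distrib)
qed

lemma readouts_scale:
  assumes "f \<in> readouts m F"
  shows "(\<lambda>x. c * f x) \<in> readouts m F"
proof -
  obtain w b where "\<And>x. f x = (\<Sum>j<m. w j * F (coords x) j) + b"
    using assms unfolding readouts_def by blast
  then show ?thesis unfolding readouts_def
    by (intro CollectI exI[of _ "\<lambda>j. c * w j"] exI[of _ "c * b"])
      (simp add: algebra_simps sum_distrib_left)
qed

lemma network_of_readouts:
  fixes g :: "nat \<Rightarrow> real^'a \<Rightarrow> real"
  assumes "relu_composition k l F" and "\<And>i. i < m \<Longrightarrow> g i \<in> readouts l F"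
  shows "\<exists>H. relu_composition k m H \<and> (\<forall>x i. H (coords x) i = (if i < m then g i x else 0))"
proof -
  obtain w b where wb: "\<And>i x. i < m \<Longrightarrow> g i x = (\<Sum>j<l. w i j * F (coords x) j) + b i"
    using assms(2) unfolding readouts_def mem_Collect_eq by metis
  define B where "B x = (\<lambda>i. if i < m then (\<Sum>j<l. w i j * x j) + b i else 0)" for x
  have "affine_layer l m B" unfolding affine_layer_def B_def by blast
  from relu_composition_affine[OF assms(1) this] show ?thesis
    by (intro exI[of _ "B \<circ> F"]) (simp add: B_def wb)
qed

text \<open>
  The new layer receives \<open>g\<close> and \<open>-g\<close> for every \<open>g\<close> in \<open>S\<close>. After the activation, \<open>max g 0\<close> is
  available, and \<open>g\<close> itself is recovered as \<open>max g 0 - max (-g) 0\<close>. Keeping the old functions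
  available is what allows networks of different depths to be combined.
\<close>

lemma extend_by_relu:
  fixes S :: "(real^'a \<Rightarrow> real) set"
  assumes "relu_composition k l F" "finite S" "S \<subseteq> readouts l F"
  shows "\<exists>m H. relu_composition k m H \<and> S \<subseteq> readouts m H \<and>
    (\<forall>g\<in>S. (\<lambda>x. max (g x) 0) \<in> readouts m H)"
proof -
  obtain gs where gs: "set gs = S" using \<open>finite S\<close> finite_list by blast
  define r where "r = length gs"
  have mem: "gs ! i \<in> readouts l F" if "i < r" for i
    using that gs assms(3) by (auto simp: r_def)
  \<comment> \<open>The first \<open>r\<close> outputs are the functions in \<open>S\<close>, the next \<open>r\<close> their negatives.\<close>
  define h where "h i = (if i < r then gs ! i else (\<lambda>x. (-1) * (gs ! (i - r)) x))" for i
  have "h i \<in> readouts l F" if "i < 2 * r" for i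
    using that mem readouts_scale[OF mem, of "i - r" "-1"] by (auto simp: h_def)
  then obtain H where H: "relu_composition k (2 * r) H"
    "\<And>x i. H (coords x) i = (if i < 2 * r then h i x else 0)"
    using network_of_readouts[OF assms(1), of "2 * r" h] by blast
  \<comment> \<open>An identity layer, because a network ends with an affine map and not with an activation.\<close>
  define A where "A x = (\<lambda>i. if i < 2 * r then x i else 0)" for x :: "nat \<Rightarrow> real"
  have "affine_layer (2 * r) (2 * r) A"
    unfolding affine_layer_def A_def
    by (intro exI[of _ "\<lambda>i j. if i = j then 1 else 0"] exI[of _ "\<lambda>_. 0"])
      (auto simp: if_distrib[of "\<lambda>c. c * _"] cong: if_cong)
  then have net: "relu_composition k (2 * r) (A \<circ> relu \<circ> H)"
    by (rule relu_composition.step[OF H(1)])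
  have parts: "(\<lambda>x. max (g x) 0) \<in> readouts (2 * r) (A \<circ> relu \<circ> H)"
    "(\<lambda>x. max (- g x) 0) \<in> readouts (2 * r) (A \<circ> relu \<circ> H)" if "g \<in> S" for g
  proof -
    obtain i where i: "i < r" "g = gs ! i" using \<open>g \<in> S\<close> gs by (auto simp: in_set_conv_nth r_def)
    show "(\<lambda>x. max (g x) 0) \<in> readouts (2 * r) (A \<circ> relu \<circ> H)"
      using readouts_output[of i "2 * r" "A \<circ> relu \<circ> H", where 'a = 'a] i by (simp add: A_def relu_def H h_def)
    show "(\<lambda>x. max (- g x) 0) \<in> readouts (2 * r) (A \<circ> relu \<circ> H)"
      using readouts_output[of "i + r" "2 * r" "A \<circ> relu \<circ> H", where 'a = 'a] i by (simp add: A_def relu_def H h_def)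
  qed
  have "g \<in> readouts (2 * r) (A \<circ> relu \<circ> H)" if "g \<in> S" for g
  proof -
    have "(\<lambda>x. max (g x) 0 + (-1) * max (- g x) 0) \<in> readouts (2 * r) (A \<circ> relu \<circ> H)"
      by (intro readouts_add readouts_scale parts that)
    moreover have "(\<lambda>x. max (g x) 0 + (-1) * max (- g x) 0) = g" by (auto simp: max_def)
    ultimately show ?thesis by simp
  qed
  with net parts show ?thesis by blast
qed

inductive relu_expr :: "(real^'a \<Rightarrow> real) \<Rightarrow> bool" where
  coordinate: "relu_expr (\<lambda>x. x $ i)"
| const: "relu_expr (\<lambda>_. c)"
| add: "relu_expr f \<Longrightarrow> relu_expr g \<Longrightarrow> relu_expr (\<lambda>x. f x + g x)"
| scale: "relu_expr f \<Longrightarrow> relu_expr (\<lambda>x. c * f x)"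
| relu: "relu_expr f \<Longrightarrow> relu_expr (\<lambda>x. max (f x) 0)"

definition jointly_realizable :: "(real^'a \<Rightarrow> real) set \<Rightarrow> bool" where
  "jointly_realizable S \<longleftrightarrow> (\<exists>m F. relu_composition CARD('a) m F \<and> S \<subseteq> readouts m F)"

lemma jointly_realizable_coordinates:
  "jointly_realizable (range (\<lambda>i (x::real^'a). x $ i))"
proof -
  define A where "A x = (\<lambda>i. if i < CARD('a) then x i else 0)" for x :: "nat \<Rightarrow> real"
  have "affine_layer CARD('a) CARD('a) A"
    unfolding affine_layer_def A_def
    by (intro exI[of _ "\<lambda>i j. if i = j then 1 else 0"] exI[of _ "\<lambda>_. 0"])
      (auto simp: if_distrib[of "\<lambda>c. c * _"] cong: if_cong)
  then have "relu_composition CARD('a) CARD('a) A" by (rule relu_composition.single)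
  moreover have "(\<lambda>x::real^'a. x $ i) \<in> readouts CARD('a) A" for i
  proof -
    have "bij_betw (from_nat_into (UNIV :: 'a set)) {..<CARD('a)} UNIV"
      by (simp add: bij_betw_from_nat_into_finite)
    then obtain j where "j < CARD('a)" "i = from_nat_into UNIV j"
      unfolding bij_betw_def by (metis UNIV_I imageE lessThan_iff)
    then show ?thesis
      using readouts_output[of j "CARD('a)" A, where 'a = 'a] by (simp add: A_def coords_def)
  qed
  ultimately show ?thesis unfolding jointly_realizable_def by blast
qed

text \<open>
  By induction on the expression. The set \<open>S\<close> has to be arbitrary here: the operands of a sum are
  inserted one after the other, with the first already present when the second is built. Containing
  the coordinates, it also gives access to the network input at any depth.
\<close>

lemma jointly_realizable_insert:
  fixes g :: "real^'a \<Rightarrow> real"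
  assumes "relu_expr g" "finite S" "jointly_realizable S" "range (\<lambda>i x. x $ i) \<subseteq> S"
  shows "jointly_realizable (insert g S)"
  using assms
proof (induction g arbitrary: S)
  case (coordinate i)
  then have "insert (\<lambda>x. x $ i) S = S" by auto
  with coordinate show ?case by simp
next
  case (const c)
  then show ?case unfolding jointly_realizable_def using readouts_const by blast
next
  case (add f g)
  have "jointly_realizable (insert f S)" by (rule add.IH(1)[OF add.prems])
  then have "jointly_realizable (insert g (insert f S))"
    using add.prems by (intro add.IH(2)) auto
  then obtain m F where mF: "relu_composition CARD('a) m F" "insert g (insert f S) \<subseteq> readouts m F"
    unfolding jointly_realizable_def by auto
  then have "(\<lambda>x. f x + g x) \<in> readouts m F" by (intro readouts_add) auto
  with mF show ?case unfolding jointly_realizable_def by auto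
next
  case (scale f c)
  from scale.IH[OF scale.prems] obtain m F
    where mF: "relu_composition CARD('a) m F" "insert f S \<subseteq> readouts m F"
    unfolding jointly_realizable_def by auto
  then have "(\<lambda>x. c * f x) \<in> readouts m F" by (intro readouts_scale) auto
  with mF show ?case unfolding jointly_realizable_def by auto
next
  case (relu f)
  from relu.IH[OF relu.prems] obtain l F
    where lF: "relu_composition CARD('a) l F" "insert f S \<subseteq> readouts l F"
    unfolding jointly_realizable_def by auto
  have "finite (insert f S)" using relu.prems by simp
  from extend_by_relu[OF lF(1) this lF(2)] show ?case unfolding jointly_realizable_def by auto
qed

lemma relu_network_of_exprs:
  fixes f :: "real^'a \<Rightarrow> real^'b"
  assumes "\<And>i. relu_expr (\<lambda>x. f x $ i)"
  shows "relu_network f"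
proof -
  have "jointly_realizable (T \<union> range (\<lambda>i (x::real^'a). x $ i))"
    if "finite T" "\<forall>g\<in>T. relu_expr g" for T :: "(real^'a \<Rightarrow> real) set"
    using that
    by (induction T) (auto intro!: jointly_realizable_coordinates jointly_realizable_insert)
  from this[of "range (\<lambda>i x. f x $ i)"] obtain m F
    where F: "relu_composition CARD('a) m F" "range (\<lambda>i x. f x $ i) \<subseteq> readouts m F"
    using assms unfolding jointly_realizable_def by auto
  obtain H where "relu_composition CARD('a) CARD('b) H"
      "\<And>x j. H (coords x) j = (if j < CARD('b) then f x $ from_nat_into UNIV j else 0)"
    using network_of_readouts[OF F(1), of "CARD('b)" "\<lambda>j x. f x $ from_nat_into UNIV j"] F(2) by blast
  then show ?thesis unfolding relu_network_def
    by (intro exI[of _ H]) (simp add: coords_def[of "f _"] fun_eq_iff)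
qed

section \<open>Uniform density of ReLU networks\<close>

lemma relu_expr_max:
  assumes "relu_expr f" "relu_expr g"
  shows "relu_expr (\<lambda>x. max (f x) (g x))"
proof -
  have "relu_expr (\<lambda>x. f x + max (g x + (-1) * f x) 0)"
    by (intro relu_expr.intros assms)
  moreover have "(\<lambda>x. f x + max (g x + (-1) * f x) 0) = (\<lambda>x. max (f x) (g x))"
    by (auto simp: max_def)
  ultimately show ?thesis by simp
qed

lemma relu_expr_min:
  assumes "relu_expr f" "relu_expr g"
  shows "relu_expr (\<lambda>x. min (f x) (g x))"
proof -
  have "relu_expr (\<lambda>x. (-1) * max ((-1) * f x) ((-1) * g x))"
    by (intro relu_expr_max relu_expr.intros assms)
  moreover have "(\<lambda>x. (-1) * max ((-1) * f x) ((-1) * g x)) = (\<lambda>x. min (f x) (g x))"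
    by (auto simp: max_def min_def)
  ultimately show ?thesis by simp
qed

lemma relu_expr_continuous: "relu_expr f \<Longrightarrow> continuous_on S f"
  by (induction rule: relu_expr.induct) (auto intro!: continuous_intros)

lemma relu_expr_dense:
  fixes F :: "real^'a \<Rightarrow> real"
  assumes "compact S" "continuous_on S F" "e > 0"
  shows "\<exists>f. relu_expr f \<and> (\<forall>x\<in>S. \<bar>f x - F x\<bar> < e)"
proof -
  have "\<exists>f\<in>Collect relu_expr. \<forall>x\<in>S. \<bar>f x - F x\<bar> < e"
  proof (rule lattice_approximation[OF assms])
    show "\<exists>f\<in>Collect relu_expr. f x = F x \<and> f y = F y" for x y
    proof (cases "x = y")
      case True
      then show ?thesis using relu_expr.const by auto
    next
      case False
      then obtain i where "x $ i \<noteq> y $ i" by (auto simp: vec_eq_iff)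
      define f where "f z = F x + (F y - F x) / (y $ i - x $ i) * (z $ i + - (x $ i))" for z
      have "relu_expr f" unfolding f_def
        by (rule relu_expr.add[OF relu_expr.const relu_expr.scale[OF
              relu_expr.add[OF relu_expr.coordinate relu_expr.const]]])
      then show ?thesis using \<open>x $ i \<noteq> y $ i\<close> by (intro bexI[of _ f]) (auto simp: f_def)
    qed
    show "Collect relu_expr \<noteq> ({} :: (real^'a \<Rightarrow> real) set)" using relu_expr.const by blast
  qed (auto intro: relu_expr_continuous relu_expr_max relu_expr_min)
  then show ?thesis by auto
qed

lemma relu_matrix_network_dense:
  fixes g :: "real^'a \<Rightarrow> real^'n^'h"
  assumes "compact S" "continuous_on S g" "e > 0"
  shows "\<exists>V. relu_matrix_network V \<and> (\<forall>x\<in>S. dist (V x) (g x) < e)"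
proof -
  \<comment> \<open>An error below \<open>d\<close> in each entry gives a norm error below \<open>e\<close>, by comparison with the \<open>l\<^sup>1\<close> norm.\<close>
  define d where "d = e / (CARD('h) * CARD('n))"
  have d: "d > 0" using \<open>e > 0\<close> by (simp add: d_def)
  have "\<exists>f. relu_expr f \<and> (\<forall>x\<in>S. \<bar>f x - g x $ i $ j\<bar> < d)" for i j
    by (intro relu_expr_dense d assms continuous_on_component)
  then obtain f where f: "\<And>i j. relu_expr (f i j)"
      "\<And>i j x. x \<in> S \<Longrightarrow> \<bar>f i j x - g x $ i $ j\<bar> < d"
    by metis
  define V :: "real^'a \<Rightarrow> real^'n^'h" where "V x = (\<chi> i j. f i j x)" for x
  have "relu_matrix_network V" unfolding relu_matrix_network_def
    by (rule relu_network_of_exprs) (simp add: V_def f)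
  moreover have "dist (V x) (g x) < e" if "x \<in> S" for x
  proof -
    have "dist (V x) (g x) \<le> (\<Sum>i\<in>UNIV. norm ((V x - g x) $ i))"
      unfolding dist_norm norm_vec_def by (rule L2_set_le_sum) simp
    also have "\<dots> \<le> (\<Sum>i\<in>UNIV. \<Sum>j\<in>UNIV. \<bar>(V x - g x) $ i $ j\<bar>)"
      by (intro sum_mono norm_le_l1_cart)
    also have "\<dots> < (\<Sum>i\<in>(UNIV::'h set). \<Sum>j\<in>(UNIV::'n set). d)"
      by (intro sum_strict_mono) (auto simp: V_def f that)
    also have "\<dots> = e" by (simp add: d_def)
    finally show ?thesis .
  qed
  ultimately show ?thesis by blast
qed

section \<open>Continuity of simple functions on large compact sets\<close>

text \<open>
  Inner regularity is a theorem about measures on all Borel sets, so it is applied to the image of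
  \<open>P\<close> under the inclusion of \<open>\<Theta>\<close>.
\<close>

lemma inner_approx_by_compact:
  fixes \<Theta> :: "'a::{second_countable_topology, complete_space} set"
  assumes "finite_measure P" and sets_P: "sets P = sets (restrict_space borel \<Theta>)" and "closed \<Theta>"
    and A: "A \<in> sets P" and "e > 0"
  shows "\<exists>C. C \<subseteq> A \<and> compact C \<and> emeasure P (A - C) < ennreal e"
proof -
  interpret finite_measure P by fact
  have space_P: "space P = \<Theta>" using sets_eq_imp_space_eq[OF sets_P] by (simp add: space_restrict_space)
  have borel_sub: "B \<in> sets P" if "B \<in> sets borel" "B \<subseteq> \<Theta>" for B
    unfolding sets_P using that \<open>closed \<Theta>\<close> by (subst sets_restrict_space_iff) auto
  have id: "(\<lambda>x. x) \<in> measurable P borel"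
    by (rule measurableI) (auto simp: space_P sets_P sets_restrict_space)
  define P' where "P' = distr P borel (\<lambda>x. x)"
  have P'_eq: "emeasure P' B = emeasure P B" if "B \<in> sets borel" "B \<subseteq> \<Theta>" for B
    unfolding P'_def using that id by (subst emeasure_distr) (auto simp: space_P Int_absorb2)
  have A': "A \<in> sets borel" "A \<subseteq> \<Theta>"
    using A \<open>closed \<Theta>\<close> unfolding sets_P by (auto simp: sets_restrict_space_iff)
  have "finite_measure P'" unfolding P'_def by (rule finite_measure_distr[OF id])
  then have fin': "emeasure P' (space P') \<noteq> \<infinity>" by (simp add: finite_measure.emeasure_finite)
  have sup: "emeasure P A = (SUP C \<in> {C. C \<subseteq> A \<and> compact C}. emeasure P' C)"
    using inner_regular[OF _ fin' A'(1)] P'_eq[OF A'] by (simp add: P'_def)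
  have "\<exists>C\<in>{C. C \<subseteq> A \<and> compact C}. emeasure P A < emeasure P' C + ennreal e"
  proof (rule SUP_approx_ennreal[OF \<open>e > 0\<close> _ sup])
    show "{C. C \<subseteq> A \<and> compact C} \<noteq> {}" using compact_empty by blast
  qed simp
  then obtain C where C: "C \<subseteq> A" "compact C" "emeasure P A < emeasure P' C + ennreal e" by auto
  have C': "C \<in> sets borel" "C \<subseteq> \<Theta>" using C A' by (auto intro: borel_compact)
  then have CP: "C \<in> sets P" by (rule borel_sub)
  have "emeasure P A < emeasure P C + ennreal e" using C(3) by (simp add: P'_eq[OF C'])
  then have "measure P A < measure P C + e"
    using \<open>e > 0\<close> by (simp add: emeasure_eq_measure ennreal_less_iff flip: ennreal_plus)
  then have "measure P (A - C) < e"
    using finite_measure_Diff[OF A CP C(1)] by simp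
  then have "emeasure P (A - C) < ennreal e" by (simp add: emeasure_eq_measure ennreal_less_iff)
  then show ?thesis using C by blast
qed

text \<open>
  Lusin's theorem for a function with finitely many values: approximate each level set from inside
  by a compact set. On the union of these disjoint compact sets the function is locally constant.
\<close>

lemma simple_Lusin:
  fixes \<Theta> :: "'a::{second_countable_topology, complete_space} set" and k :: "'a \<Rightarrow> nat"
    and v :: "nat \<Rightarrow> 'e::topological_space"
  assumes "finite_measure P" and sets_P: "sets P = sets (restrict_space borel \<Theta>)" and "closed \<Theta>"
    and k: "k \<in> measurable P (count_space UNIV)" and bound: "\<And>x. x \<in> \<Theta> \<Longrightarrow> k x \<le> K" and "e > 0"
  shows "\<exists>C. C \<subseteq> \<Theta> \<and> compact C \<and> emeasure P (\<Theta> - C) < ennreal e \<and> continuous_on C (\<lambda>x. v (k x))"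
proof -
  have space_P: "space P = \<Theta>" using sets_eq_imp_space_eq[OF sets_P] by (simp add: space_restrict_space)
  define A where "A i = {x \<in> \<Theta>. k x = i}" for i
  have A: "A i \<in> sets P" for i
    using measurable_sets[OF k, of "{i}"] by (simp add: A_def space_P vimage_def Int_def conj_commute)
  define d where "d = e / (2 * (K + 1))"
  have "d > 0" using \<open>e > 0\<close> by (simp add: d_def)
  then have "\<exists>C. C \<subseteq> A i \<and> compact C \<and> emeasure P (A i - C) < ennreal d" for i
    by (intro inner_approx_by_compact[OF assms(1-3) A])
  then obtain C where C: "\<And>i. C i \<subseteq> A i" "\<And>i. compact (C i)" "\<And>i. emeasure P (A i - C i) < ennreal d"
    by metis
  have C_sets: "C i \<in> sets P" for i
    unfolding sets_P using C(1,2)[of i] \<open>closed \<Theta>\<close>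
    by (subst sets_restrict_space_iff) (auto simp: A_def intro: borel_compact)
  have "emeasure P (\<Theta> - (\<Union>i\<le>K. C i)) \<le> emeasure P (\<Union>i\<le>K. A i - C i)"
    using A C_sets bound by (intro emeasure_mono) (auto simp: A_def)
  also have "\<dots> \<le> (\<Sum>i\<le>K. emeasure P (A i - C i))"
    using A C_sets by (intro emeasure_subadditive_finite) auto
  also have "\<dots> \<le> (\<Sum>i\<le>K. ennreal d)"
    using C(3) by (intro sum_mono less_imp_le)
  also have "\<dots> = ennreal (\<Sum>i\<le>K. d)"
    using \<open>d > 0\<close> by (intro sum_ennreal) auto
  also have "\<dots> < ennreal e"
    using \<open>e > 0\<close> by (simp add: d_def ennreal_less_iff field_simps add_pos_nonneg)
  finally have "emeasure P (\<Theta> - (\<Union>i\<le>K. C i)) < ennreal e" .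
  moreover have "continuous_on (\<Union>i\<le>K. C i) (\<lambda>x. v (k x))"
  proof (rule continuous_on_closed_Union)
    show "continuous_on (C i) (\<lambda>x. v (k x))" for i
      using C(1)[of i] by (subst continuous_on_cong[OF refl, of _ _ "\<lambda>_. v i"]) (auto simp: A_def)
  qed (auto intro: C compact_imp_closed)
  moreover have "(\<Union>i\<le>K. C i) \<subseteq> \<Theta>" "compact (\<Union>i\<le>K. C i)" using C(1,2) by (auto simp: A_def)
  ultimately show ?thesis by blast
qed

section \<open>Near-optimal selection from a dense class\<close>

text \<open>
  An uncountable supremum of continuous functions is lower semicontinuous: its strict superlevel
  sets are unions of relatively open sets.
\<close>

lemma worst_case_measurable:
  fixes \<phi> :: "'a::topological_space \<Rightarrow> 'b \<Rightarrow> real"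
  assumes sets_P: "sets P = sets (restrict_space borel \<Theta>)"
    and cont: "\<And>\<nu>. \<nu> \<in> T \<Longrightarrow> continuous_on \<Theta> (\<lambda>\<mu>. \<phi> \<mu> \<nu>)"
  shows "(\<lambda>\<mu>. SUP \<nu>\<in>T. ennreal (\<phi> \<mu> \<nu>)) \<in> borel_measurable P"
proof (rule borel_measurableI_greater)
  fix y :: ennreal
  have space_P: "space P = \<Theta>" using sets_eq_imp_space_eq[OF sets_P] by (simp add: space_restrict_space)
  have "\<exists>U. open U \<and> U \<inter> \<Theta> = {\<mu> \<in> \<Theta>. y < ennreal (\<phi> \<mu> \<nu>)}" if "\<nu> \<in> T" for \<nu>
  proof -
    have "continuous_on \<Theta> (\<lambda>\<mu>. ennreal (\<phi> \<mu> \<nu>))" by (intro continuous_on_ennreal cont that)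
    then have "openin (top_of_set \<Theta>) (\<Theta> \<inter> (\<lambda>\<mu>. ennreal (\<phi> \<mu> \<nu>)) -` {y<..})"
      by (intro continuous_openin_preimage_gen) auto
    then obtain U where "open U" "\<Theta> \<inter> (\<lambda>\<mu>. ennreal (\<phi> \<mu> \<nu>)) -` {y<..} = \<Theta> \<inter> U"
      by (auto simp: openin_open)
    then show ?thesis by (intro exI[of _ U]) auto
  qed
  then obtain U where U: "\<And>\<nu>. \<nu> \<in> T \<Longrightarrow> open (U \<nu>) \<and> U \<nu> \<inter> \<Theta> = {\<mu> \<in> \<Theta>. y < ennreal (\<phi> \<mu> \<nu>)}"
    by metis
  then have "{\<mu> \<in> space P. y < (SUP \<nu>\<in>T. ennreal (\<phi> \<mu> \<nu>))} = \<Theta> \<inter> (\<Union>\<nu>\<in>T. U \<nu>)"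
    unfolding space_P less_SUP_iff by blast
  moreover have "open (\<Union>\<nu>\<in>T. U \<nu>)" using U by blast
  ultimately show "{\<mu> \<in> space P. y < (SUP \<nu>\<in>T. ennreal (\<phi> \<mu> \<nu>))} \<in> sets P"
    unfolding sets_P sets_restrict_space by auto
qed

text \<open>
  The costs below are arbitrary reals, so \<open>a\<close> may be negative; then \<open>ennreal a = 0\<close>.
\<close>

lemma ennreal_add_le: "0 \<le> b \<Longrightarrow> ennreal (a + b) \<le> ennreal a + ennreal b"
  by (cases "0 \<le> a") (simp_all add: ennreal_plus ennreal_neg ennreal_leI)

text \<open>
  Here \<open>\<phi> \<mu> \<nu> v\<close> is the cost of the decision \<open>v\<close> when the parameters are \<open>\<mu>\<close> and \<open>\<nu>\<close>. The
  decision may depend on \<open>\<mu>\<close> but not on \<open>\<nu>\<close>. In the application it is the matrix \<open>V\<close> and the cost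
  is the projection error.
\<close>

locale compact_cost =
  fixes \<Theta> :: "'a::euclidean_space set" and \<Theta>' :: "'b::euclidean_space set"
    and \<phi> :: "'a \<Rightarrow> 'b \<Rightarrow> 'e::euclidean_space \<Rightarrow> real"
  assumes compact_parameters: "compact \<Theta>" "compact \<Theta>'"
    and cost_continuous: "continuous_on (\<Theta> \<times> \<Theta>' \<times> UNIV) (\<lambda>(\<mu>, \<nu>, v). \<phi> \<mu> \<nu> v)"
begin

definition worst_cost :: "'a \<Rightarrow> 'e \<Rightarrow> ennreal" where
  "worst_cost \<mu> v = (SUP \<nu>\<in>\<Theta>'. ennreal (\<phi> \<mu> \<nu> v))"

lemma cost_equicontinuous:
  assumes "e > 0"
  shows "\<exists>d>0. \<forall>\<mu>\<in>\<Theta>. \<forall>\<nu>\<in>\<Theta>'. \<forall>v w. norm v \<le> B \<longrightarrow> norm w \<le> B \<longrightarrow> dist v w < d \<longrightarrow>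
    ennreal (\<phi> \<mu> \<nu> v) \<le> ennreal (\<phi> \<mu> \<nu> w) + ennreal e"
proof -
  have "continuous_on (\<Theta> \<times> \<Theta>' \<times> cball 0 B) (\<lambda>(\<mu>, \<nu>, v). \<phi> \<mu> \<nu> v)"
    by (rule continuous_on_subset[OF cost_continuous]) auto
  then have "uniformly_continuous_on (\<Theta> \<times> \<Theta>' \<times> cball 0 B) (\<lambda>(\<mu>, \<nu>, v). \<phi> \<mu> \<nu> v)"
    by (intro compact_uniformly_continuous compact_Times compact_parameters compact_cball)
  then obtain d where "d > 0" and d: "\<And>x y. \<lbrakk>x \<in> \<Theta> \<times> \<Theta>' \<times> cball 0 B; y \<in> \<Theta> \<times> \<Theta>' \<times> cball 0 B; dist y x < d\<rbrakk>
      \<Longrightarrow> dist ((\<lambda>(\<mu>, \<nu>, v). \<phi> \<mu> \<nu> v) y) ((\<lambda>(\<mu>, \<nu>, v). \<phi> \<mu> \<nu> v) x) < e"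
    using \<open>e > 0\<close> unfolding uniformly_continuous_on_def by metis
  have "ennreal (\<phi> \<mu> \<nu> v) \<le> ennreal (\<phi> \<mu> \<nu> w) + ennreal e"
    if "\<mu> \<in> \<Theta>" "\<nu> \<in> \<Theta>'" "norm v \<le> B" "norm w \<le> B" "dist v w < d" for \<mu> \<nu> v w
  proof -
    have "\<phi> \<mu> \<nu> v \<le> \<phi> \<mu> \<nu> w + e"
      using d[of "(\<mu>, \<nu>, w)" "(\<mu>, \<nu>, v)"] that by (simp add: dist_Pair_Pair dist_real_def abs_less_iff)
    then have "ennreal (\<phi> \<mu> \<nu> v) \<le> ennreal (\<phi> \<mu> \<nu> w + e)" by (rule ennreal_leI)
    also have "\<dots> \<le> ennreal (\<phi> \<mu> \<nu> w) + ennreal e" using \<open>e > 0\<close> by (intro ennreal_add_le) auto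
    finally show ?thesis .
  qed
  with \<open>d > 0\<close> show ?thesis by auto
qed

lemma cost_bounded:
  "\<exists>M>0. \<forall>\<mu>\<in>\<Theta>. \<forall>\<nu>\<in>\<Theta>'. \<forall>v. norm v \<le> B \<longrightarrow> \<phi> \<mu> \<nu> v \<le> M"
proof -
  have "continuous_on (\<Theta> \<times> \<Theta>' \<times> cball 0 B) (\<lambda>(\<mu>, \<nu>, v). \<phi> \<mu> \<nu> v)"
    by (rule continuous_on_subset[OF cost_continuous]) auto
  then have "bounded ((\<lambda>(\<mu>, \<nu>, v). \<phi> \<mu> \<nu> v) ` (\<Theta> \<times> \<Theta>' \<times> cball 0 B))"
    by (intro compact_imp_bounded compact_continuous_image compact_Times compact_parameters compact_cball)
  then obtain M where M: "M > 0" "\<And>y. y \<in> (\<lambda>(\<mu>, \<nu>, v). \<phi> \<mu> \<nu> v) ` (\<Theta> \<times> \<Theta>' \<times> cball 0 B) \<Longrightarrow> norm y \<le> M"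
    unfolding bounded_pos by blast
  have "\<phi> \<mu> \<nu> v \<le> M" if "\<mu> \<in> \<Theta>" "\<nu> \<in> \<Theta>'" "norm v \<le> B" for \<mu> \<nu> v
    using M(2)[of "\<phi> \<mu> \<nu> v"] that by force
  with M(1) show ?thesis by auto
qed

lemma worst_cost_measurable:
  assumes "sets P = sets (restrict_space borel \<Theta>)"
  shows "(\<lambda>\<mu>. worst_cost \<mu> v) \<in> borel_measurable P"
  unfolding worst_cost_def
proof (rule worst_case_measurable[OF assms])
  fix \<nu> assume "\<nu> \<in> \<Theta>'"
  have "continuous_on \<Theta> (\<lambda>\<mu>. case (\<mu>, \<nu>, v) of (\<mu>, \<nu>, v) \<Rightarrow> \<phi> \<mu> \<nu> v)"
    using \<open>\<nu> \<in> \<Theta>'\<close>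
    by (intro continuous_on_compose2[OF cost_continuous] continuous_intros) auto
  then show "continuous_on \<Theta> (\<lambda>\<mu>. \<phi> \<mu> \<nu> v)" by simp
qed

text \<open>
  By equicontinuity, moving \<open>v\<close> to a nearby point of a countable dense set changes the worst-case
  cost by an arbitrarily small amount. The gain is that countable infima preserve measurability and
  can be exhausted by finite ones.
\<close>

lemma countable_infimum:
  "\<exists>v :: nat \<Rightarrow> 'e. \<forall>\<mu>\<in>\<Theta>. (INF k. worst_cost \<mu> (v k)) = (INF w. worst_cost \<mu> w)"
proof -
  obtain D :: "'e set" where D: "countable D" "\<And>X. open X \<Longrightarrow> X \<noteq> {} \<Longrightarrow> \<exists>d\<in>D. d \<in> X"
    using countable_dense_exists by auto
  have "D \<noteq> {}" using D(2)[of UNIV] by auto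
  define v where "v = from_nat_into D"
  have "range v = D" unfolding v_def using \<open>D \<noteq> {}\<close> D(1) by (rule range_from_nat_into)
  have "(INF k. worst_cost \<mu> (v k)) \<le> worst_cost \<mu> w" if "\<mu> \<in> \<Theta>" for \<mu> w
  proof (rule ennreal_le_epsilon)
    fix e :: real assume "e > 0"
    obtain d where "d > 0" and d: "\<forall>\<mu>\<in>\<Theta>. \<forall>\<nu>\<in>\<Theta>'. \<forall>v x. norm v \<le> norm w + 1 \<longrightarrow> norm x \<le> norm w + 1 \<longrightarrow>
        dist v x < d \<longrightarrow> ennreal (\<phi> \<mu> \<nu> v) \<le> ennreal (\<phi> \<mu> \<nu> x) + ennreal e"
      using cost_equicontinuous[OF \<open>e > 0\<close>, of "norm w + 1"] by auto
    obtain x where x: "x \<in> D" "x \<in> ball w (min d 1)"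
      using D(2)[of "ball w (min d 1)"] \<open>d > 0\<close>
      by (metis centre_in_ball empty_iff min_less_iff_conj open_ball zero_less_one)
    then obtain k where k: "x = v k" using \<open>range v = D\<close> by blast
    have "norm x \<le> norm w + 1"
      using x norm_triangle_ineq2[of x w] by (simp add: dist_norm norm_minus_commute)
    have "worst_cost \<mu> (v k) \<le> worst_cost \<mu> w + ennreal e"
      unfolding worst_cost_def k[symmetric]
    proof (rule SUP_least)
      fix \<nu> assume "\<nu> \<in> \<Theta>'"
      then have "ennreal (\<phi> \<mu> \<nu> x) \<le> ennreal (\<phi> \<mu> \<nu> w) + ennreal e"
        using d \<open>\<mu> \<in> \<Theta>\<close> x \<open>norm x \<le> norm w + 1\<close> by (simp add: dist_commute)
      also have "\<dots> \<le> (SUP \<nu>\<in>\<Theta>'. ennreal (\<phi> \<mu> \<nu> w)) + ennreal e"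
        by (intro add_right_mono SUP_upper \<open>\<nu> \<in> \<Theta>'\<close>)
      finally show "ennreal (\<phi> \<mu> \<nu> x) \<le> (SUP \<nu>\<in>\<Theta>'. ennreal (\<phi> \<mu> \<nu> w)) + ennreal e" .
    qed
    then show "(INF k. worst_cost \<mu> (v k)) \<le> worst_cost \<mu> w + ennreal e"
      by (rule order_trans[OF INF_lower[OF UNIV_I]])
  qed
  then have "(INF k. worst_cost \<mu> (v k)) = (INF w. worst_cost \<mu> w)" if "\<mu> \<in> \<Theta>" for \<mu>
    using that by (intro antisym INF_greatest) (auto intro!: INF_lower)
  then show ?thesis by blast
qed

text \<open>
  Monotone convergence for the decreasing sequence of minima over initial segments of a dense
  sequence. Compactness bounds the cost of the first candidate, which makes the integrals finite.
\<close>

lemma finitely_many_candidates: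
  assumes "prob_space P" and sets_P: "sets P = sets (restrict_space borel \<Theta>)" and "e > 0"
  shows "\<exists>(v :: nat \<Rightarrow> 'e) K. (\<integral>\<^sup>+ \<mu>. (INF k\<in>{..K}. worst_cost \<mu> (v k)) \<partial>P)
    < (\<integral>\<^sup>+ \<mu>. (INF w. worst_cost \<mu> w) \<partial>P) + ennreal e"
proof -
  interpret prob_space P by fact
  have space_P: "space P = \<Theta>" using sets_eq_imp_space_eq[OF sets_P] by (simp add: space_restrict_space)
  obtain v :: "nat \<Rightarrow> 'e" where v: "\<And>\<mu>. \<mu> \<in> \<Theta> \<Longrightarrow> (INF k. worst_cost \<mu> (v k)) = (INF w. worst_cost \<mu> w)"
    using countable_infimum by blast
  define f where "f K \<mu> = (INF k\<in>{..K}. worst_cost \<mu> (v k))" for K \<mu>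
  have meas: "f K \<in> borel_measurable P" for K
    unfolding f_def using worst_cost_measurable[OF sets_P] by (intro borel_measurable_INF) auto
  have "decseq f"
    unfolding f_def by (intro decseq_SucI le_funI INF_superset_mono) auto
  have finite: "(\<integral>\<^sup>+ \<mu>. f K \<mu> \<partial>P) < \<infinity>" for K
  proof -
    obtain M where "\<forall>\<mu>\<in>\<Theta>. \<forall>\<nu>\<in>\<Theta>'. \<forall>w. norm w \<le> norm (v 0) \<longrightarrow> \<phi> \<mu> \<nu> w \<le> M"
      using cost_bounded[of "norm (v 0)"] by auto
    then have "f K \<mu> \<le> ennreal M" if "\<mu> \<in> \<Theta>" for \<mu>
      unfolding f_def worst_cost_def using that by (intro INF_lower2[of 0] SUP_least ennreal_leI) auto
    then have "(\<integral>\<^sup>+ \<mu>. f K \<mu> \<partial>P) \<le> (\<integral>\<^sup>+ \<mu>. ennreal M \<partial>P)"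
      by (intro nn_integral_mono) (auto simp: space_P)
    also have "\<dots> < \<infinity>" by (simp add: emeasure_space_1)
    finally show ?thesis .
  qed
  have "(INF K. f K \<mu>) = (INF w. worst_cost \<mu> w)" if "\<mu> \<in> \<Theta>" for \<mu>
    unfolding v[OF that, symmetric] f_def
  proof (intro antisym INF_greatest)
    show "(INF K. INF k\<in>{..K}. worst_cost \<mu> (v k)) \<le> worst_cost \<mu> (v k)" for k
      by (rule INF_lower2[of k], simp, rule INF_lower, simp)
    show "(INF k. worst_cost \<mu> (v k)) \<le> worst_cost \<mu> (v k)" for k
      by (rule INF_lower) simp
  qed
  then have "(\<integral>\<^sup>+ \<mu>. (INF w. worst_cost \<mu> w) \<partial>P) = (\<integral>\<^sup>+ \<mu>. (INF K. f K \<mu>) \<partial>P)"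
    by (intro nn_integral_cong) (simp add: space_P)
  also have "\<dots> = (INF K. \<integral>\<^sup>+ \<mu>. f K \<mu> \<partial>P)"
    by (rule nn_integral_monotone_convergence_INF_decseq[OF \<open>decseq f\<close> meas finite])
  finally have eq: "(\<integral>\<^sup>+ \<mu>. (INF w. worst_cost \<mu> w) \<partial>P) = (INF K. \<integral>\<^sup>+ \<mu>. f K \<mu> \<partial>P)" .
  define I where "I = (INF K. \<integral>\<^sup>+ \<mu>. f K \<mu> \<partial>P)"
  have "I \<le> (\<integral>\<^sup>+ \<mu>. f 0 \<mu> \<partial>P)" unfolding I_def by (rule INF_lower) simp
  then have "I \<noteq> \<infinity>" using finite[of 0] by auto
  then have "I < I + ennreal e"
    using ennreal_add_left_cancel_less[of I 0 "ennreal e"] \<open>e > 0\<close> by simp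
  then obtain K where "(\<integral>\<^sup>+ \<mu>. f K \<mu> \<partial>P) < I + ennreal e"
    unfolding I_def by (subst (asm) (1) INF_less_iff) auto
  then show ?thesis unfolding eq I_def[symmetric] unfolding f_def by blast
qed

text \<open>
  The set \<open>\<N>\<close> stands for any class of functions that is uniformly dense in the continuous ones.
  The error budget is \<open>\<epsilon> / 2\<close> for restricting to finitely many candidates, \<open>\<epsilon> / 4\<close> for the
  uniform approximation, and \<open>\<epsilon> / 4\<close> for the set where the selection is not continuous.
\<close>

lemma near_optimal_approximation:
  assumes P: "prob_space P" and sets_P: "sets P = sets (restrict_space borel \<Theta>)"
    and Q: "prob_space Q" and sets_Q: "sets Q = sets (restrict_space borel \<Theta>')"
    and dense: "\<And>g d. \<lbrakk>continuous_on \<Theta> g; d > 0\<rbrakk> \<Longrightarrow> \<exists>V\<in>\<N>. \<forall>\<mu>\<in>\<Theta>. dist (V \<mu>) (g \<mu>) < d"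
    and "\<epsilon> > 0"
  shows "\<exists>V\<in>\<N>. (\<integral>\<^sup>+ \<mu>. \<integral>\<^sup>+ \<nu>. ennreal (\<phi> \<mu> \<nu> (V \<mu>)) \<partial>Q \<partial>P)
    < ennreal \<epsilon> + (\<integral>\<^sup>+ \<mu>. (INF w. worst_cost \<mu> w) \<partial>P)"
proof -
  interpret P: prob_space P by fact
  interpret Q: prob_space Q by fact
  have space_P: "space P = \<Theta>" using sets_eq_imp_space_eq[OF sets_P] by (simp add: space_restrict_space)
  have space_Q: "space Q = \<Theta>'" using sets_eq_imp_space_eq[OF sets_Q] by (simp add: space_restrict_space)
  have closed: "closed \<Theta>" using compact_parameters compact_imp_closed by blast
  note [measurable] = worst_cost_measurable[OF sets_P]
  obtain v :: "nat \<Rightarrow> 'e" and K where vK: "(\<integral>\<^sup>+ \<mu>. (INF k\<in>{..K}. worst_cost \<mu> (v k)) \<partial>P)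
      < (\<integral>\<^sup>+ \<mu>. (INF w. worst_cost \<mu> w) \<partial>P) + ennreal (\<epsilon> / 2)"
    using finitely_many_candidates[OF P sets_P, of "\<epsilon> / 2"] \<open>\<epsilon> > 0\<close> by (auto simp only: half_gt_zero)
  define f where "f \<mu> = (INF k\<in>{..K}. worst_cost \<mu> (v k))" for \<mu>
  have f[measurable]: "f \<in> borel_measurable P"
    unfolding f_def by (intro borel_measurable_INF) auto
  \<comment> \<open>The first candidate attaining the minimum: measurable, as a least index is determined by countably many comparisons.\<close>
  define sel where "sel \<mu> = (LEAST k. worst_cost \<mu> (v k) \<le> f \<mu>)" for \<mu>
  have sel_meas: "sel \<in> measurable P (count_space UNIV)"
    unfolding sel_def by measurable
  have sel: "worst_cost \<mu> (v (sel \<mu>)) \<le> f \<mu>" "sel \<mu> \<le> K" for \<mu>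
  proof -
    have "\<exists>k\<le>K. worst_cost \<mu> (v k) \<le> f \<mu>"
    proof (rule ccontr)
      assume contr: "\<not> ?thesis"
      have "f \<mu> < Inf ((\<lambda>k. worst_cost \<mu> (v k)) ` {..K})"
      proof (rule finite_imp_less_Inf)
        show "worst_cost \<mu> (v 0) \<in> (\<lambda>k. worst_cost \<mu> (v k)) ` {..K}" by simp
        show "f \<mu> < x" if "x \<in> (\<lambda>k. worst_cost \<mu> (v k)) ` {..K}" for x
          using that contr unfolding not_le[symmetric] by blast
      qed simp
      then show False by (simp add: f_def)
    qed
    then obtain k where k: "k \<le> K" "worst_cost \<mu> (v k) \<le> f \<mu>" by blast
    show "worst_cost \<mu> (v (sel \<mu>)) \<le> f \<mu>"
      unfolding sel_def by (rule LeastI[of "\<lambda>k. worst_cost \<mu> (v k) \<le> f \<mu>", OF k(2)])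
    show "sel \<mu> \<le> K"
      unfolding sel_def using Least_le[of "\<lambda>k. worst_cost \<mu> (v k) \<le> f \<mu>", OF k(2)] k(1) by simp
  qed
  \<comment> \<open>Bounding the candidates fixes \<open>M\<close> and \<open>d\<close> before \<open>C\<close>, so that \<open>C\<close> can be chosen in terms of \<open>M\<close>; the slack in \<open>B + 1\<close> is for the approximant.\<close>
  define B where "B = (\<Sum>k\<le>K. norm (v k))"
  have v_bound: "norm (v (sel \<mu>)) \<le> B" for \<mu>
    unfolding B_def using sel(2) by (intro member_le_sum) auto
  have "B \<ge> 0" unfolding B_def by (intro sum_nonneg) auto
  obtain M where "M > 0"
    and M: "\<forall>\<mu>\<in>\<Theta>. \<forall>\<nu>\<in>\<Theta>'. \<forall>w. norm w \<le> B + 1 \<longrightarrow> \<phi> \<mu> \<nu> w \<le> M"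
    using cost_bounded[of "B + 1"] by auto
  obtain d where "d > 0" and d: "\<forall>\<mu>\<in>\<Theta>. \<forall>\<nu>\<in>\<Theta>'. \<forall>v w. norm v \<le> B + 1 \<longrightarrow> norm w \<le> B + 1 \<longrightarrow>
      dist v w < d \<longrightarrow> ennreal (\<phi> \<mu> \<nu> v) \<le> ennreal (\<phi> \<mu> \<nu> w) + ennreal (\<epsilon> / 4)"
    using cost_equicontinuous[of "\<epsilon> / 4" "B + 1"] \<open>\<epsilon> > 0\<close> by auto
  obtain C where C: "C \<subseteq> \<Theta>" "compact C" "emeasure P (\<Theta> - C) < ennreal (\<epsilon> / (4 * M))"
      "continuous_on C (\<lambda>\<mu>. v (sel \<mu>))"
    using simple_Lusin[OF P.finite_measure_axioms sets_P closed sel_meas sel(2), of "\<epsilon> / (4 * M)" v]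
      \<open>\<epsilon> > 0\<close> \<open>M > 0\<close> by auto
  have C_sets[measurable]: "\<Theta> - C \<in> sets P"
    unfolding sets_P using C closed
    by (subst sets_restrict_space_iff) (auto intro: borel_compact borel_closed)
  have "closedin (top_of_set \<Theta>) C" using C by (auto intro: closed_subset compact_imp_closed)
  then obtain g where g: "continuous_on \<Theta> g" "\<And>\<mu>. \<mu> \<in> C \<Longrightarrow> g \<mu> = v (sel \<mu>)" "\<And>\<mu>. \<mu> \<in> \<Theta> \<Longrightarrow> norm (g \<mu>) \<le> B"
    using Tietze[OF C(4) _ \<open>B \<ge> 0\<close> v_bound] by blast
  obtain V where V: "V \<in> \<N>" "\<And>\<mu>. \<mu> \<in> \<Theta> \<Longrightarrow> dist (V \<mu>) (g \<mu>) < min d 1"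
    using dense[OF g(1), of "min d 1"] \<open>d > 0\<close> by auto
  have V_bound: "norm (V \<mu>) \<le> B + 1" if "\<mu> \<in> \<Theta>" for \<mu>
    using V(2)[OF that] g(3)[OF that] norm_triangle_ineq2[of "V \<mu>" "g \<mu>"] by (simp add: dist_norm)
  have inner: "(\<integral>\<^sup>+ \<nu>. ennreal (\<phi> \<mu> \<nu> (V \<mu>)) \<partial>Q)
      \<le> f \<mu> + ennreal (\<epsilon> / 4) + ennreal M * indicator (\<Theta> - C) \<mu>" if "\<mu> \<in> \<Theta>" for \<mu>
  proof -
    have "ennreal (\<phi> \<mu> \<nu> (V \<mu>)) \<le> f \<mu> + ennreal (\<epsilon> / 4) + ennreal M * indicator (\<Theta> - C) \<mu>"
      if "\<nu> \<in> \<Theta>'" for \<nu>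
    proof (cases "\<mu> \<in> C")
      case True
      have "ennreal (\<phi> \<mu> \<nu> (V \<mu>)) \<le> ennreal (\<phi> \<mu> \<nu> (v (sel \<mu>))) + ennreal (\<epsilon> / 4)"
        using d \<open>\<mu> \<in> \<Theta>\<close> that V(2)[OF \<open>\<mu> \<in> \<Theta>\<close>] V_bound[OF \<open>\<mu> \<in> \<Theta>\<close>] g(2)[OF True] v_bound[of \<mu>]
        by auto
      also have "ennreal (\<phi> \<mu> \<nu> (v (sel \<mu>))) \<le> worst_cost \<mu> (v (sel \<mu>))"
        unfolding worst_cost_def by (intro SUP_upper that)
      also have "\<dots> \<le> f \<mu>" by (rule sel)
      finally show ?thesis using True by (simp add: add_right_mono)
    next
      case False
      have "ennreal (\<phi> \<mu> \<nu> (V \<mu>)) \<le> ennreal M"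
        using M V_bound \<open>\<mu> \<in> \<Theta>\<close> that by (intro ennreal_leI) auto
      then show ?thesis using False \<open>\<mu> \<in> \<Theta>\<close> by (simp add: add_increasing)
    qed
    then have "(\<integral>\<^sup>+ \<nu>. ennreal (\<phi> \<mu> \<nu> (V \<mu>)) \<partial>Q)
        \<le> (\<integral>\<^sup>+ \<nu>. f \<mu> + ennreal (\<epsilon> / 4) + ennreal M * indicator (\<Theta> - C) \<mu> \<partial>Q)"
      by (intro nn_integral_mono) (simp add: space_Q)
    then show ?thesis by (simp add: Q.emeasure_space_1)
  qed
  have "(\<integral>\<^sup>+ \<mu>. \<integral>\<^sup>+ \<nu>. ennreal (\<phi> \<mu> \<nu> (V \<mu>)) \<partial>Q \<partial>P)
      \<le> (\<integral>\<^sup>+ \<mu>. f \<mu> + ennreal (\<epsilon> / 4) + ennreal M * indicator (\<Theta> - C) \<mu> \<partial>P)"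
    by (intro nn_integral_mono inner) (simp add: space_P)
  also have "\<dots> = (\<integral>\<^sup>+ \<mu>. f \<mu> \<partial>P) + ennreal (\<epsilon> / 4) + ennreal M * emeasure P (\<Theta> - C)"
    by (simp add: nn_integral_add nn_integral_cmult P.emeasure_space_1)
  also have "\<dots> \<le> (\<integral>\<^sup>+ \<mu>. f \<mu> \<partial>P) + ennreal (\<epsilon> / 4) + ennreal M * ennreal (\<epsilon> / (4 * M))"
    using C(3) by (intro add_left_mono mult_left_mono) auto
  also have "ennreal M * ennreal (\<epsilon> / (4 * M)) = ennreal (\<epsilon> / 4)"
    using \<open>M > 0\<close> \<open>\<epsilon> > 0\<close> by (simp flip: ennreal_mult)
  also have "(\<integral>\<^sup>+ \<mu>. f \<mu> \<partial>P) + ennreal (\<epsilon> / 4) + ennreal (\<epsilon> / 4) = (\<integral>\<^sup>+ \<mu>. f \<mu> \<partial>P) + ennreal (\<epsilon> / 2)"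
    using \<open>\<epsilon> > 0\<close> by (simp add: add.assoc flip: ennreal_plus)
  also have "\<dots> < (\<integral>\<^sup>+ \<mu>. (INF w. worst_cost \<mu> w) \<partial>P) + ennreal (\<epsilon> / 2) + ennreal (\<epsilon> / 2)"
    using vK by (simp add: f_def ennreal_add_left_cancel_less add.commute[of _ "ennreal (\<epsilon> / 2)"])
  also have "\<dots> = ennreal \<epsilon> + (\<integral>\<^sup>+ \<mu>. (INF w. worst_cost \<mu> w) \<partial>P)"
    using \<open>\<epsilon> > 0\<close> by (simp add: add.assoc add.commute flip: ennreal_plus)
  finally show ?thesis using V(1) by blast
qed

end

section \<open>The projection error as a cost\<close>

lemma continuous_on_matrix_vector_mult:
  fixes A :: "'a::topological_space \<Rightarrow> real^'n^'m"
  assumes "continuous_on S A" "continuous_on S x"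
  shows "continuous_on S (\<lambda>z. A z *v x z)"
  unfolding matrix_vector_mult_def
  by (intro continuous_on_vec_lambda continuous_intros assms)

lemma continuous_on_gram_norm [continuous_intros]:
  "continuous_on S f \<Longrightarrow> continuous_on S (\<lambda>x. gram_norm G (f x))"
  unfolding gram_norm_def by (intro continuous_intros continuous_on_matrix_vector_mult)

lemma continuous_on_matrix_matrix_mult:
  fixes A :: "'a::topological_space \<Rightarrow> real^'n^'m" and B :: "'a \<Rightarrow> real^'k^'n"
  assumes "continuous_on S A" "continuous_on S B"
  shows "continuous_on S (\<lambda>z. A z ** B z)"
  unfolding matrix_matrix_mult_def
  by (intro continuous_on_vec_lambda continuous_intros assms)

lemma continuous_on_transpose:
  fixes A :: "'a::topological_space \<Rightarrow> real^'n^'m"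
  assumes "continuous_on S A"
  shows "continuous_on S (\<lambda>z. transpose (A z))"
  unfolding transpose_def by (intro continuous_on_vec_lambda continuous_intros assms)


lemma gram_error_compact_cost:
  fixes u :: "real^'p \<Rightarrow> real^'q \<Rightarrow> real^'h"
  assumes "compact \<Theta>" "compact \<Theta>'" and u: "continuous_on (\<Theta> \<times> \<Theta>') (\<lambda>(\<mu>, \<nu>). u \<mu> \<nu>)"
  shows "compact_cost \<Theta> \<Theta>' (\<lambda>\<mu> \<nu> (V :: real^'n^'h).
    gram_norm G (u \<mu> \<nu> - (V ** transpose V ** G) *v u \<mu> \<nu>))"
proof
  have "continuous_on (\<Theta> \<times> \<Theta>' \<times> UNIV)
      (\<lambda>z :: (real^'p) \<times> (real^'q) \<times> (real^'n^'h). case (fst z, fst (snd z)) of (\<mu>, \<nu>) \<Rightarrow> u \<mu> \<nu>)"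
    by (intro continuous_on_compose2[OF u] continuous_intros) auto
  then have "continuous_on (\<Theta> \<times> \<Theta>' \<times> UNIV) (\<lambda>z :: (real^'p) \<times> (real^'q) \<times> (real^'n^'h). u (fst z) (fst (snd z)))"
    by simp
  then show "continuous_on (\<Theta> \<times> \<Theta>' \<times> UNIV) (\<lambda>(\<mu>, \<nu>, V :: real^'n^'h).
      gram_norm G (u \<mu> \<nu> - (V ** transpose V ** G) *v u \<mu> \<nu>))"
    unfolding case_prod_beta
    by (intro continuous_intros continuous_on_matrix_vector_mult continuous_on_matrix_matrix_mult
        continuous_on_transpose)
qed (fact assms)+

theorem theorem1:
  fixes \<Theta> :: "(real^'p) set" and \<Theta>' :: "(real^'q) set"
    and P :: "(real^'p) measure" and Q :: "(real^'q) measure"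
    and u :: "real^'p \<Rightarrow> real^'q \<Rightarrow> real^'h"
    and G :: "real^'h^'h"
    and \<epsilon> :: real
  assumes "compact \<Theta>" and "compact \<Theta>'"
    and "prob_space P" and "sets P = sets (restrict_space borel \<Theta>)"
    and "prob_space Q" and "sets Q = sets (restrict_space borel \<Theta>')"
    and "continuous_on (\<Theta> \<times> \<Theta>') (\<lambda>(\<mu>, \<nu>). u \<mu> \<nu>)"
    and "transpose G = G" and "\<And>x. x \<noteq> 0 \<Longrightarrow> 0 < x \<bullet> (G *v x)"
    and "\<epsilon> > 0"
  shows "\<exists>V :: real^'p \<Rightarrow> real^'n^'h. relu_matrix_network V \<and>
    (\<integral>\<^sup>+ \<mu>. \<integral>\<^sup>+ \<nu>. ennreal (gram_norm G (u \<mu> \<nu> - (V \<mu> ** transpose (V \<mu>) ** G) *v u \<mu> \<nu>)) \<partial>Q \<partial>P)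
      < ennreal \<epsilon> + (\<integral>\<^sup>+ \<mu>. kolmogorov_width TYPE('n) G (u \<mu> ` \<Theta>') \<partial>P)"
proof -
  interpret compact_cost \<Theta> \<Theta>' "\<lambda>\<mu> \<nu> (V :: real^'n^'h).
      gram_norm G (u \<mu> \<nu> - (V ** transpose V ** G) *v u \<mu> \<nu>)"
    using assms(1,2,7) by (rule gram_error_compact_cost)
  have width: "kolmogorov_width TYPE('n) G (u \<mu> ` \<Theta>') = (INF V. worst_cost \<mu> V)" for \<mu>
    unfolding kolmogorov_width_def worst_cost_def by (simp add: image_image)
  have dense: "\<exists>V\<in>Collect relu_matrix_network. \<forall>\<mu>\<in>\<Theta>. dist (V \<mu>) (g \<mu>) < d"
    if "continuous_on \<Theta> g" "d > 0" for g :: "real^'p \<Rightarrow> real^'n^'h" and d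
    using relu_matrix_network_dense[OF assms(1) that] by blast
  show ?thesis
    using near_optimal_approximation[OF assms(3-6) dense \<open>\<epsilon> > 0\<close>] unfolding width by blast
qed

end
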